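(* Let $A,A_1,\dots,A_n,B_1,\dots,B_m\in\mathcal{S}^{\ell}$, $\mathcal{A}(x)=\sum_{i=1}^nx_iA_i$, $\mathcal{B}(y)=\sum_{j=1}^my_jB_j$, and let $$S=\{x\in\mathbb{R}^n\mid\exists y\in\mathbb{R}^m:\ \mathcal{A}(x)+\mathcal{B}(y)+A\succcurlyeq0\}.$$ Assume that $S$ is closed and $S\neq\mathbb{R}^n$; that $\bar x\in\mathbb{R}^n$ is a point with $\mathcal{A}(\bar x)+\mathcal{B}(\bar y)+A\succ0$ for some $\bar y\in\mathbb{R}^m$; and that $\bar d$ is a point with $\bar d\in\operatorname{int}0^{\infty}S$ and $\|\bar d\|\le1$. Let $\varepsilon>0$. Then Algorithm 2 (described in the context), run on input $\mathcal{A},\mathcal{B},A,\bar x,\bar d,\varepsilon$, terminates after finitely many steps and is correct, i.e. it returns an inner $\varepsilon$-approximation $\mathcal{I}$ and an outer $\varepsilon$-approximation $\mathcal{O}$ of $0^{\infty}S$.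
   Context: Notation. $\mathcal{S}^{\ell}$ is the space of real symmetric $\ell\times\ell$ matrices with $S_1\cdot S_2=\operatorname{trace}(S_1S_2)$; $X\succcurlyeq0$ ($X\succ0$) means positive semidefinite (definite). $\|\cdot\|$ is the Euclidean norm and $\|\cdot\|_{\infty}$ the maximum norm. $H^-(w,\gamma)=\{x\in\mathbb{R}^n\mid w^{\mathsf{T}}x\le\gamma\}$. The recession cone of a convex set $S$ is $0^{\infty}S=\{d\in\mathbb{R}^n\mid x\in S\Rightarrow x+d\in S\}$. $\operatorname{cone}$ denotes the conical hull. Distances. $d_{\mathsf{H}}(C_1,C_2)=\max\{\sup_{c_1\in C_1}\inf_{c_2\in C_2}\|c_1-c_2\|,\ \sup_{c_2\in C_2}\inf_{c_1\in C_1}\|c_2-c_1\|\}$ is the Hausdorff distance. For closed convex cones, $\bar d_{\mathsf{H}}(K_1,K_2)=d_{\mathsf{H}}(K_1\cap B,K_2\cap B)$ with $B=\{x\in\mathbb{R}^n\mid\|x\|\le1\}$. For a closed convex cone $K$ and $\varepsilon>0$, a polyhedral cone $R$ is an outer (inner) $\varepsilon$-approximation of $K$ if $K\subseteq R$ ($R\subseteq K$) and $\bar d_{\mathsf{H}}(R,K)\le\varepsilon$. Subproblems. For $d\in\mathbb{R}^n\setminus\{0\}$: - $\mathrm{P}_2(S,\bar x,d)$: $\max t$ s.t. $\mathcal{A}(x)+\mathcal{B}(y)+A\succcurlyeq0$, $x=\bar x+td$ (variables $x\in\mathbb{R}^n,y\in\mathbb{R}^m,t\in\mathbb{R}$). -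 $\mathrm{D}_2(S,\bar x,d)$: $\min(\mathcal{A}(\bar x)+A)\cdot U$ s.t. $A_i\cdot U=-w_i$ ($i=1,\dots,n$), $B_j\cdot U=0$ ($j=1,\dots,m$), $d^{\mathsf{T}}w=1$, $U\succcurlyeq0$ (variables $U\in\mathcal{S}^{\ell}$, $w\in\mathbb{R}^n$). Algorithm 2 (subproblems are solved exactly; any optimal solution may be chosen). 1. Compute a solution $(U^*,w^* )$ to $\mathrm{D}_2(S,\bar x,-\bar d)$. 2. Set $\mathcal{I}\leftarrow\operatorname{cone}\{\bar d\}$. 3. Set $\mathcal{O}\leftarrow H^-(w^*/\|w^*\|,0)$. 4. Repeat the following until Stop is TRUE at the end of a pass: Set Stop $\leftarrow$ TRUE. For every nonzero vertex $v$ of the polytope $\{x\in\mathcal{O}\mid\|x\|_{\infty}\le1\}$ (the vertices at the start of this for loop), and for $k=1,2,\dots,\lceil\log_2(\|v-\bar d\|/\varepsilon)\rceil$ in increasing order (no $k$ if this bound is less than $1$ or $v=\bar d$): set $$d_v^k\leftarrow\frac{2^k-1}{2^k}v+\frac1{2^k}\bar d$$ and (a) if $d_v^k\in\mathcal{I}$, continue with the next $k$; (b) else, if $\mathrm{P}_2(S,\bar x,d_v^k)$ is unbounded, set $\mathcal{I}\leftarrow\operatorname{cone}(\mathcal{I}\cup\{d_v^k\})$ and continue with the next $k$; (c) else, compute a solution $(U^*,w^* )$ to $\mathrm{D}_2(S,\bar x,d_v^k)$, set $\mathcal{O}\leftarrow\mathcal{O}\cap H^-(w^*/\|w^*\|,0)$,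 set Stop $\leftarrow$ FALSE, and leave the loop over $k$ (proceed to the next vertex $v$). 5. Return $\mathcal{I}$ and $\mathcal{O}$. *)

theory Defs
  imports "HOL-Analysis.Analysis"
begin

section \<open>Symmetric matrices and spectrahedral shadows\<close>

definition sym_mat :: "real^'l^'l \<Rightarrow> bool" where
  "sym_mat X \<longleftrightarrow> transpose X = X"

definition mat_dot :: "real^'l^'l \<Rightarrow> real^'l^'l \<Rightarrow> real" where
  "mat_dot X Y = trace (X ** Y)"

definition psd :: "real^'l^'l \<Rightarrow> bool" where
  "psd X \<longleftrightarrow> sym_mat X \<and> (\<forall>z. 0 \<le> z \<bullet> (X *v z))"

definition pos_def :: "real^'l^'l \<Rightarrow> bool" where
  "pos_def X \<longleftrightarrow> sym_mat X \<and> (\<forall>z. z \<noteq> 0 \<longrightarrow> 0 < z \<bullet> (X *v z))"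

text \<open>
  The number \<open>m\<close> of auxiliary variables may be zero, so \<open>y\<close> is represented by a function on the
  naturals of which only the entries \<open>y 1, \<dots>, y m\<close> matter.  The dimensions \<open>n\<close> and \<open>l\<close> are
  index types; both are positive whenever the shadow is a nonempty proper subset of the space.
\<close>

definition lin_x :: "('n::finite \<Rightarrow> real^'l^'l) \<Rightarrow> real^'n \<Rightarrow> real^'l^'l" where
  "lin_x A x = (\<Sum>i\<in>UNIV. (x $ i) *\<^sub>R A i)"

definition lin_y :: "nat \<Rightarrow> (nat \<Rightarrow> real^'l^'l) \<Rightarrow> (nat \<Rightarrow> real) \<Rightarrow> real^'l^'l" where
  "lin_y m B y = (\<Sum>j=1..m. y j *\<^sub>R B j)"

definition shadow ::
  "('n::finite \<Rightarrow> real^'l^'l) \<Rightarrow> nat \<Rightarrow> (nat \<Rightarrow> real^'l^'l) \<Rightarrow> real^'l^'l \<Rightarrow> (real^'n) set" where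
  "shadow A m B A0 = {x. \<exists>y. psd (lin_x A x + lin_y m B y + A0)}"


section \<open>Recession cones and approximation of cones\<close>

definition recession_cone :: "'a::real_vector set \<Rightarrow> 'a set" where
  "recession_cone S = {d. \<forall>x\<in>S. x + d \<in> S}"

text \<open>Suprema and infima are taken in the reals, so this is the Hausdorff distance only for
  nonempty bounded sets; below it is only applied to such sets.\<close>

definition hausdorff_dist :: "'a::real_normed_vector set \<Rightarrow> 'a set \<Rightarrow> real" where
  "hausdorff_dist C1 C2 =
     max (SUP c1\<in>C1. INF c2\<in>C2. norm (c1 - c2)) (SUP c2\<in>C2. INF c1\<in>C1. norm (c2 - c1))"

definition cone_dist :: "'a::real_normed_vector set \<Rightarrow> 'a set \<Rightarrow> real" where
  "cone_dist K1 K2 = hausdorff_dist (K1 \<inter> cball 0 1) (K2 \<inter> cball 0 1)"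

definition polyhedral_cone :: "'a::euclidean_space set \<Rightarrow> bool" where
  "polyhedral_cone R \<longleftrightarrow> polyhedron R \<and> convex_cone R"

definition outer_approx :: "real \<Rightarrow> 'a::euclidean_space set \<Rightarrow> 'a set \<Rightarrow> bool" where
  "outer_approx \<epsilon> K R \<longleftrightarrow> polyhedral_cone R \<and> K \<subseteq> R \<and> cone_dist R K \<le> \<epsilon>"

definition inner_approx :: "real \<Rightarrow> 'a::euclidean_space set \<Rightarrow> 'a set \<Rightarrow> bool" where
  "inner_approx \<epsilon> K R \<longleftrightarrow> polyhedral_cone R \<and> R \<subseteq> K \<and> cone_dist R K \<le> \<epsilon>"


section \<open>The subproblems\<close>

definition P2_feasible ::
  "('n::finite \<Rightarrow> real^'l^'l) \<Rightarrow> nat \<Rightarrow> (nat \<Rightarrow> real^'l^'l) \<Rightarrow> real^'l^'l \<Rightarrow> real^'n \<Rightarrow> real^'n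
    \<Rightarrow> real^'n \<Rightarrow> (nat \<Rightarrow> real) \<Rightarrow> real \<Rightarrow> bool" where
  "P2_feasible A m B A0 xbar d x y t \<longleftrightarrow>
     psd (lin_x A x + lin_y m B y + A0) \<and> x = xbar + t *\<^sub>R d"

definition P2_unbounded ::
  "('n::finite \<Rightarrow> real^'l^'l) \<Rightarrow> nat \<Rightarrow> (nat \<Rightarrow> real^'l^'l) \<Rightarrow> real^'l^'l \<Rightarrow> real^'n \<Rightarrow> real^'n
    \<Rightarrow> bool" where
  "P2_unbounded A m B A0 xbar d \<longleftrightarrow>
     \<not> bdd_above {t. \<exists>x y. P2_feasible A m B A0 xbar d x y t}"

definition D2_feasible ::
  "('n::finite \<Rightarrow> real^'l^'l) \<Rightarrow> nat \<Rightarrow> (nat \<Rightarrow> real^'l^'l) \<Rightarrow> real^'n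
    \<Rightarrow> real^'l^'l \<Rightarrow> real^'n \<Rightarrow> bool" where
  "D2_feasible A m B d U w \<longleftrightarrow>
     (\<forall>i. mat_dot (A i) U = - (w $ i)) \<and>
     (\<forall>j\<in>{1..m}. mat_dot (B j) U = 0) \<and>
     d \<bullet> w = 1 \<and> psd U"

definition D2_solution ::
  "('n::finite \<Rightarrow> real^'l^'l) \<Rightarrow> nat \<Rightarrow> (nat \<Rightarrow> real^'l^'l) \<Rightarrow> real^'l^'l \<Rightarrow> real^'n \<Rightarrow> real^'n
    \<Rightarrow> real^'l^'l \<Rightarrow> real^'n \<Rightarrow> bool" where
  "D2_solution A m B A0 xbar d U w \<longleftrightarrow>
     D2_feasible A m B d U w \<and>
     (\<forall>U' w'. D2_feasible A m B d U' w' \<longrightarrow>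
        mat_dot (lin_x A xbar + A0) U \<le> mat_dot (lin_x A xbar + A0) U')"


section \<open>The algorithm\<close>

definition halfspace_le :: "real^'n \<Rightarrow> real \<Rightarrow> (real^'n) set" where
  "halfspace_le w \<gamma> = {x. w \<bullet> x \<le> \<gamma>}"

definition nonzero_vertices :: "(real^'n) set \<Rightarrow> (real^'n) set" where
  "nonzero_vertices Out = {v. v extreme_point_of {x \<in> Out. infnorm x \<le> 1} \<and> v \<noteq> 0}"

definition num_dirs :: "real \<Rightarrow> real^'n \<Rightarrow> real^'n \<Rightarrow> nat" where
  "num_dirs \<epsilon> dbar v =
     (if v = dbar then 0 else nat \<lceil>log 2 (norm (v - dbar) / \<epsilon>)\<rceil>)"

definition search_dir :: "real^'n \<Rightarrow> real^'n \<Rightarrow> nat \<Rightarrow> real^'n" where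
  "search_dir dbar v k = ((2 ^ k - 1) / 2 ^ k) *\<^sub>R v + (1 / 2 ^ k) *\<^sub>R dbar"

text \<open>
  The algorithm is a nondeterministic transition system: the choice of the dual solutions and the
  order in which the vertices are visited are arbitrary.  A configuration records the program
  location together with the current values of the variables:

  \<^item> \<open>Start\<close>: before step 1;
  \<^item> \<open>Pass Inn Out\<close>: about to begin a pass of the repeat loop;
  \<^item> \<open>Vertices Inn Out stop V\<close>: in the loop over the vertices, \<open>V\<close> being those not yet visited;
  \<^item> \<open>Dirs Inn Out stop V v k\<close>: in the inner loop for the vertex \<open>v\<close>, about to treat index \<open>k\<close>;
  \<^item> \<open>Returned Inn Out\<close>: the algorithm has returned.

  A configuration in which a required dual solution does not exist has no successor.
\<close>

datatype 'v alg2_config =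
    Start
  | Pass "'v set" "'v set"
  | Vertices "'v set" "'v set" bool "'v set"
  | Dirs "'v set" "'v set" bool "'v set" 'v nat
  | Returned "'v set" "'v set"

inductive alg2_step ::
  "('n::finite \<Rightarrow> real^'l^'l) \<Rightarrow> nat \<Rightarrow> (nat \<Rightarrow> real^'l^'l) \<Rightarrow> real^'l^'l \<Rightarrow> real^'n \<Rightarrow> real^'n
    \<Rightarrow> real \<Rightarrow> (real^'n) alg2_config \<Rightarrow> (real^'n) alg2_config \<Rightarrow> bool"
  for A m B A0 xbar dbar \<epsilon> where
  init:
    "D2_solution A m B A0 xbar (- dbar) U w \<Longrightarrow>
     alg2_step A m B A0 xbar dbar \<epsilon> Start
       (Pass (convex_cone hull {dbar}) (halfspace_le (w /\<^sub>R norm w) 0))"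
| begin_pass:
    "alg2_step A m B A0 xbar dbar \<epsilon> (Pass Inn Out)
       (Vertices Inn Out True (nonzero_vertices Out))"
| next_vertex:
    "v \<in> V \<Longrightarrow>
     alg2_step A m B A0 xbar dbar \<epsilon> (Vertices Inn Out stop V) (Dirs Inn Out stop (V - {v}) v 1)"
| end_pass_repeat:
    "alg2_step A m B A0 xbar dbar \<epsilon> (Vertices Inn Out False {}) (Pass Inn Out)"
| end_pass_return:
    "alg2_step A m B A0 xbar dbar \<epsilon> (Vertices Inn Out True {}) (Returned Inn Out)"
| dirs_done:
    "k > num_dirs \<epsilon> dbar v \<Longrightarrow>
     alg2_step A m B A0 xbar dbar \<epsilon> (Dirs Inn Out stop V v k) (Vertices Inn Out stop V)"
| dir_known:
    "k \<le> num_dirs \<epsilon> dbar v \<Longrightarrow> search_dir dbar v k \<in> Inn \<Longrightarrow>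
     alg2_step A m B A0 xbar dbar \<epsilon> (Dirs Inn Out stop V v k) (Dirs Inn Out stop V v (Suc k))"
| dir_unbounded:
    "k \<le> num_dirs \<epsilon> dbar v \<Longrightarrow> search_dir dbar v k \<notin> Inn \<Longrightarrow>
     P2_unbounded A m B A0 xbar (search_dir dbar v k) \<Longrightarrow>
     alg2_step A m B A0 xbar dbar \<epsilon> (Dirs Inn Out stop V v k)
       (Dirs (convex_cone hull (Inn \<union> {search_dir dbar v k})) Out stop V v (Suc k))"
| dir_cut:
    "k \<le> num_dirs \<epsilon> dbar v \<Longrightarrow> search_dir dbar v k \<notin> Inn \<Longrightarrow>
     \<not> P2_unbounded A m B A0 xbar (search_dir dbar v k) \<Longrightarrow>
     D2_solution A m B A0 xbar (search_dir dbar v k) U w \<Longrightarrow>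
     alg2_step A m B A0 xbar dbar \<epsilon> (Dirs Inn Out stop V v k)
       (Vertices Inn (Out \<inter> halfspace_le (w /\<^sub>R norm w) 0) False V)"

end

theory Submission
  imports Defs
begin

text \<open>
  A feasible dual pair \<open>(U, w)\<close> for a direction \<open>d\<close> gives \<open>w \<bullet> x \<le> 0\<close> on the recession cone \<open>K\<close>,
  while \<open>w \<bullet> d = 1\<close>.  Strict feasibility at \<open>xbar\<close> bounds the sublevel sets of the dual objective,
  so a dual solution exists as soon as some pair is feasible, and a separation argument provides
  one whenever the primal problem is bounded.  Hence the algorithm never gets stuck, its inner cone
  stays inside \<open>K\<close> and its outer cone around \<open>K\<close>.

  Since \<open>dbar\<close> is interior to \<open>K\<close>, a cut made because of a vertex \<open>v\<close> removes a ball around \<open>v\<close>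
  whose radius does not depend on the cut; by compactness of the cube only finitely many passes
  make a cut.  After a pass without cuts every vertex of the truncated outer cone is within \<open>\<epsilon>\<close> of
  the inner cone, hence by convexity so is every point of the outer cone in the unit ball, and
  the nearest point on a ray is not longer than the point itself.
\<close>

section \<open>Positive semidefinite matrices\<close>

lemma sym_mat_nth: "sym_mat X \<longleftrightarrow> (\<forall>i j. X $ i $ j = X $ j $ i)"
  by (auto simp: sym_mat_def transpose_def vec_eq_iff)

text \<open>Replaces the trace pairing by the Euclidean inner product on matrices, for which
  linearity, norms and continuity are at hand.\<close>

lemma mat_dot_eq_inner:
  assumes "sym_mat Y"
  shows "mat_dot X Y = X \<bullet> Y"
proof -
  have "Y $ j $ i = Y $ i $ j" for i j
    using assms by (simp add: sym_mat_nth)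
  then show ?thesis
    unfolding mat_dot_def trace_def matrix_matrix_mult_def inner_vec_def
    by (intro sum.cong refl) (simp add: inner_vec_def)
qed

text \<open>The rank-one matrix of \<open>a\<close> times its transpose. Pairing with it makes the
  quadratic form linear in the matrix, so \<open>psd\<close> becomes a system of linear
  conditions.\<close>

definition outer_square :: "real^'l \<Rightarrow> real^'l^'l" where
  "outer_square a = (\<chi> i j. a $ i * a $ j)"

lemma inner_outer_square: "X \<bullet> outer_square z = z \<bullet> (X *v z)"
  by (simp add: outer_square_def inner_vec_def matrix_vector_mult_def sum_distrib_left mult_ac)

lemma outer_square_inner_outer_square: "outer_square a \<bullet> outer_square z = (a \<bullet> z)\<^sup>2"
  by (simp add: outer_square_def inner_vec_def power2_eq_square sum_product mult_ac)

lemma psd_iff: "psd X \<longleftrightarrow> sym_mat X \<and> (\<forall>z. 0 \<le> X \<bullet> outer_square z)"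
  by (simp add: psd_def inner_outer_square)

text \<open>Serves two purposes: \<open>s\<close> equal to 1 and -1 bounds the entries of a psd
  matrix, and the minimising \<open>s\<close> produces a Schur complement.\<close>

lemma sym_quadratic_shift:
  fixes X :: "real^'l^'l"
  assumes "sym_mat X"
  shows "(z - s *\<^sub>R axis i 1) \<bullet> (X *v (z - s *\<^sub>R axis i 1))
    = z \<bullet> (X *v z) - 2 * s * (X $ i \<bullet> z) + s\<^sup>2 * X $ i $ i"
proof -
  have c: "X *v axis i 1 = X $ i"
    using assms by (simp add: matrix_vector_mult_basis column_def vec_eq_iff sym_mat_nth)
  show ?thesis
    by (simp add: matrix_vector_mult_diff_distrib matrix_vector_mult_scaleR c inner_diff_left
        inner_diff_right inner_axis' matrix_vector_mul_component inner_commute[of z "X $ i"] power2_eq_square algebra_simps)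
qed

lemma psd_diag_nonneg: "psd X \<Longrightarrow> 0 \<le> X $ i $ i"
proof -
  assume "psd X"
  then have "0 \<le> axis i 1 \<bullet> (X *v axis i 1)" unfolding psd_def by blast
  then show ?thesis
    by (simp add: matrix_vector_mult_basis column_def inner_axis')
qed

text \<open>The quadratic form is nonnegative at the difference and at the sum of two unit vectors.
  In particular a psd matrix with zero diagonal vanishes.\<close>

lemma psd_entry_bound:
  assumes "psd X"
  shows "\<bar>X $ i $ j\<bar> \<le> (X $ i $ i + X $ j $ j) / 2"
proof -
  have s: "sym_mat X" using assms by (simp add: psd_def)
  have q: "0 \<le> X $ j $ j - 2 * s * X $ i $ j + s\<^sup>2 * X $ i $ i" for s
  proof -
    have "0 \<le> (axis j 1 - s *\<^sub>R axis i 1) \<bullet> (X *v (axis j 1 - s *\<^sub>R axis i 1))"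
      using assms unfolding psd_def by blast
    then show ?thesis
      unfolding sym_quadratic_shift[OF s]
      by (simp add: matrix_vector_mult_basis column_def inner_axis inner_axis')
  qed
  show ?thesis using q[of 1] q[of "-1"] by (auto simp: abs_if)
qed

text \<open>Induction on the number of nonzero diagonal entries: a Schur complement kills one of them
  and splits off a multiple of a rank-one matrix.\<close>

lemma psd_inner_nonneg:
  fixes X Y :: "real^'l^'l"
  assumes "psd X" "psd Y"
  shows "0 \<le> X \<bullet> Y"
  using assms(1)
proof (induction "card {i. X $ i $ i \<noteq> 0}" arbitrary: X rule: less_induct)
  case less
  note X = less.prems
  have s: "sym_mat X" using X by (simp add: psd_def)
  show ?case
  proof (cases "\<exists>i. X $ i $ i \<noteq> 0")
    case False
    then have "X = 0"
      using psd_entry_bound[OF X] by (simp add: vec_eq_iff)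
    then show ?thesis by simp
  next
    case True
    then obtain i where i: "X $ i $ i \<noteq> 0" by blast
    then have p: "0 < X $ i $ i" using psd_diag_nonneg[OF X, of i] by simp
    define X' where "X' = X - (1 / X $ i $ i) *\<^sub>R outer_square (X $ i)"
    have X'_nth: "X' $ j $ k = X $ j $ k - X $ i $ j * X $ i $ k / X $ i $ i" for j k
      by (simp add: X'_def outer_square_def)
    have "0 \<le> X' \<bullet> outer_square z" for z
    proof -
      \<comment> \<open>This shift along axis \<open>i\<close> minimises the quadratic form, and the
        minimum is the form of the Schur complement \<open>X'\<close>.\<close>
      let ?s = "(X $ i \<bullet> z) / X $ i $ i"
      have "0 \<le> (z - ?s *\<^sub>R axis i 1) \<bullet> (X *v (z - ?s *\<^sub>R axis i 1))"
        using X unfolding psd_def by blast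
      also have "\<dots> = X' \<bullet> outer_square z"
        unfolding sym_quadratic_shift[OF s] using p
        by (simp add: X'_def inner_diff_left inner_outer_square[of X]
            outer_square_inner_outer_square field_simps power2_eq_square)
      finally show ?thesis .
    qed
    moreover have "sym_mat X'"
      using s by (simp add: sym_mat_nth X'_nth mult.commute)
    ultimately have X': "psd X'" by (simp add: psd_iff)
    have sub: "X $ j $ j \<noteq> 0" if "X' $ j $ j \<noteq> 0" for j
    proof
      assume "X $ j $ j = 0"
      moreover have "0 \<le> X $ i $ j * X $ i $ j / X $ i $ i" using p by simp
      ultimately have "X' $ j $ j \<le> 0" by (simp add: X'_nth)
      with psd_diag_nonneg[OF X', of j] that show False by simp
    qed
    have "X' $ i $ i = 0" using p by (simp add: X'_nth)
    then have "{j. X' $ j $ j \<noteq> 0} \<subset> {j. X $ j $ j \<noteq> 0}"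
      using sub i by blast
    then have "0 \<le> X' \<bullet> Y"
      using less.hyps[OF _ X'] by (simp add: psubset_card_mono)
    moreover have "0 \<le> outer_square (X $ i) \<bullet> Y"
      using \<open>psd Y\<close> by (simp add: psd_iff inner_commute)
    moreover have "X \<bullet> Y = X' \<bullet> Y + (outer_square (X $ i) \<bullet> Y) / X $ i $ i"
      by (simp add: X'_def inner_diff_left)
    ultimately show ?thesis using p by simp
  qed
qed

text \<open>The constant is the minimum of the quadratic form on the compact unit sphere;
  homogeneity carries the bound to all vectors.\<close>

lemma pos_def_lower_bound:
  fixes M :: "real^'l^'l"
  assumes "pos_def M"
  obtains c where "c > 0" "psd (M - c *\<^sub>R mat 1)"
proof -
  let ?q = "\<lambda>z. z \<bullet> (M *v z)"
  have "continuous_on (sphere 0 1) ?q"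
    by (intro continuous_intros linear_continuous_on matrix_vector_mul_bounded_linear)
  moreover have "sphere (0::real^'l) 1 \<noteq> {}" by simp
  ultimately obtain u where u: "u \<in> sphere 0 1" and min: "\<And>z. z \<in> sphere 0 1 \<Longrightarrow> ?q u \<le> ?q z"
    using continuous_attains_inf[of "sphere 0 1" ?q] by (auto simp: compact_sphere)
  have "u \<noteq> 0" using u by auto
  then have pos: "?q u > 0" using assms by (simp add: pos_def_def)
  have "?q u * (z \<bullet> z) \<le> ?q z" for z
  proof (cases "z = 0")
    case False
    have "?q u \<le> ?q (z /\<^sub>R norm z)" by (rule min) (use False in simp)
    also have "\<dots> = ?q z / (norm z)\<^sup>2"
      by (simp add: matrix_vector_mult_scaleR power2_eq_square divide_inverse)
    finally show ?thesis
      using False by (simp add: field_simps power2_norm_eq_inner)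
  qed simp
  then have "psd (M - ?q u *\<^sub>R mat 1)"
    using assms unfolding psd_def pos_def_def
    by (simp add: matrix_vector_mult_diff_rdistrib inner_diff_right scaleR_matrix_vector_assoc[symmetric])
      (simp add: sym_mat_nth mat_def)
  with pos that show thesis by blast
qed

lemma mat_1_inner: "mat 1 \<bullet> (U::real^'l^'l) = trace U"
  by (simp add: inner_vec_def mat_def trace_def if_distrib if_distribR cong: if_cong)

lemma psd_norm_le_trace:
  fixes U :: "real^'l^'l"
  assumes "psd U"
  shows "norm U \<le> (real CARD('l))\<^sup>2 * trace U"
proof -
  have t: "U $ i $ i \<le> trace U" for i
    unfolding trace_def by (rule member_le_sum) (auto simp: psd_diag_nonneg[OF assms])
  have e: "\<bar>U $ i $ j\<bar> \<le> trace U" for i j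
    proof -
    have "(U $ i $ i + U $ j $ j) / 2 \<le> (trace U + trace U) / 2"
      by (intro divide_right_mono add_mono t) simp
    with psd_entry_bound[OF assms, of i j] show ?thesis by simp
  qed
  have "norm U \<le> (\<Sum>i\<in>UNIV. norm (U $ i))"
    unfolding norm_vec_def by (rule L2_set_le_sum) simp
  also have "\<dots> \<le> (\<Sum>i\<in>UNIV. \<Sum>j\<in>UNIV. \<bar>U $ i $ j\<bar>)"
    by (intro sum_mono norm_le_l1_cart)
  also have "\<dots> \<le> (\<Sum>i\<in>(UNIV::'l set). \<Sum>j\<in>(UNIV::'l set). trace U)"
    by (intro sum_mono e)
  finally show ?thesis by (simp add: power2_eq_square)
qed

text \<open>Pairing with a positive definite matrix dominates a multiple of the trace, which
  controls the norm on the psd cone. This coercivity is how strict feasibility enters the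
  proof.\<close>

lemma pos_def_inner_ge:
  fixes M :: "real^'l^'l"
  assumes "pos_def M"
  obtains c where "c > 0" "\<And>U. psd U \<Longrightarrow> c * norm U \<le> M \<bullet> U"
proof -
  obtain c where c: "c > 0" "psd (M - c *\<^sub>R mat 1)" using pos_def_lower_bound[OF assms] .
  let ?N = "(real CARD('l))\<^sup>2"
  have "c / ?N * norm U \<le> M \<bullet> U" if "psd U" for U
  proof -
    have "c / ?N * norm U \<le> c / ?N * (?N * trace U)"
      using c by (intro mult_left_mono psd_norm_le_trace that) auto
    also have "\<dots> = c * trace U" by simp
    also have "\<dots> \<le> M \<bullet> U"
      using psd_inner_nonneg[OF c(2) that] by (simp add: inner_diff_left mat_1_inner)
    finally show ?thesis .
  qed
  moreover have "c / ?N > 0" using c by simp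
  ultimately show thesis using that by blast
qed

lemma closed_psd: "closed {X::real^'l^'l. psd X}"
proof -
  have "{X::real^'l^'l. psd X} =
      (\<Inter>i. \<Inter>j. {X. X $ i $ j = X $ j $ i}) \<inter> (\<Inter>z. {X. 0 \<le> X \<bullet> outer_square z})"
    by (auto simp: psd_iff sym_mat_nth)
  also have "closed \<dots>"
    by (intro closed_Int closed_INT ballI closed_Collect_eq closed_Collect_le continuous_intros)
  finally show ?thesis .
qed


section \<open>Recession cones and conic duality\<close>

lemma inner_real_vec: "x \<bullet> y = (\<Sum>i\<in>UNIV. x $ i * y $ i)" for x y :: "real^'n"
  by (simp add: inner_vec_def)

lemma lin_x_inner: "lin_x A x \<bullet> U = (\<Sum>i\<in>UNIV. x $ i * (A i \<bullet> U))"
  by (simp add: lin_x_def inner_sum_left)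

lemma lin_y_inner: "lin_y m B y \<bullet> U = (\<Sum>j=1..m. y j * (B j \<bullet> U))"
  by (simp add: lin_y_def inner_sum_left)

lemma lin_x_add: "lin_x A (x + y) = lin_x A x + lin_x A y"
  by (simp add: lin_x_def scaleR_left_distrib sum.distrib)

lemma lin_x_scaleR: "lin_x A (c *\<^sub>R x) = c *\<^sub>R lin_x A x"
  by (simp add: lin_x_def scaleR_sum_right)

lemma lin_y_add: "lin_y m B (\<lambda>j. x j + y j) = lin_y m B x + lin_y m B y"
  by (simp add: lin_y_def scaleR_left_distrib sum.distrib)

lemma lin_y_scaleR: "lin_y m B (\<lambda>j. c * y j) = c *\<^sub>R lin_y m B y"
  by (simp add: lin_y_def scaleR_sum_right)

lemma psd_add: "psd X \<Longrightarrow> psd Y \<Longrightarrow> psd (X + Y)"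
  by (simp add: psd_iff sym_mat_nth inner_add_left)

lemma psd_scaleR: "psd X \<Longrightarrow> 0 \<le> c \<Longrightarrow> psd (c *\<^sub>R X)"
  by (simp add: psd_iff sym_mat_nth)

lemma pos_def_imp_psd: "pos_def X \<Longrightarrow> psd X"
  unfolding pos_def_def psd_def
  by (metis inner_zero_left order.refl order.strict_implies_order)

lemma convex_shadow: "convex (shadow A m B A0)"
proof (rule convexI)
  fix x x' and u v :: real
  assume x: "x \<in> shadow A m B A0" "x' \<in> shadow A m B A0" and uv: "0 \<le> u" "0 \<le> v" "u + v = 1"
  obtain y y' where y: "psd (lin_x A x + lin_y m B y + A0)" "psd (lin_x A x' + lin_y m B y' + A0)"
    using x by (auto simp: shadow_def)
  have "A0 = u *\<^sub>R A0 + v *\<^sub>R A0"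
    using uv by (metis scaleR_left_distrib scaleR_one)
  then have "lin_x A (u *\<^sub>R x + v *\<^sub>R x') + lin_y m B (\<lambda>j. u * y j + v * y' j) + A0
      = u *\<^sub>R (lin_x A x + lin_y m B y + A0) + v *\<^sub>R (lin_x A x' + lin_y m B y' + A0)"
    by (simp only: lin_x_add lin_x_scaleR lin_y_add lin_y_scaleR scaleR_right_distrib)
      (simp add: algebra_simps)
  also have "psd \<dots>"
    by (rule psd_add[OF psd_scaleR[OF y(1) uv(1)] psd_scaleR[OF y(2) uv(2)]])
  finally show "u *\<^sub>R x + v *\<^sub>R x' \<in> shadow A m B A0"
    by (auto simp: shadow_def)
qed

section \<open>Recession cones of convex sets\<close>

lemma recession_cone_iterate:
  "d \<in> recession_cone S \<Longrightarrow> x \<in> S \<Longrightarrow> x + real n *\<^sub>R d \<in> S"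
proof (induction n)
  case (Suc n)
  then have "(x + real n *\<^sub>R d) + d \<in> S" by (auto simp: recession_cone_def)
  then show ?case by (simp add: algebra_simps)
qed simp

lemma convex_cone_recession_cone:
  fixes S :: "'a::real_vector set"
  assumes "convex S"
  shows "convex_cone (recession_cone S)"
  unfolding convex_cone_iff
proof (intro conjI ballI allI impI)
  show "0 \<in> recession_cone S" by (simp add: recession_cone_def)
next
  fix x y assume "x \<in> recession_cone S" "y \<in> recession_cone S"
  then show "x + y \<in> recession_cone S"
    by (auto simp: recession_cone_def simp flip: add.assoc)
next
  fix d and c :: real assume d: "d \<in> recession_cone S" and c: "0 \<le> c"
  show "c *\<^sub>R d \<in> recession_cone S"
    unfolding recession_cone_def
  proof (intro CollectI ballI)
    fix x assume x: "x \<in> S"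
    \<comment> \<open>Only integer multiples of \<open>d\<close> are available so far;
      \<open>x + c d\<close> lies on the segment from \<open>x\<close> to
      \<open>x + n d\<close>.\<close>
    obtain n :: nat where n: "c < real n" using reals_Archimedean2 by blast
    have "(1 - c / n) *\<^sub>R x + (c / n) *\<^sub>R (x + real n *\<^sub>R d) \<in> S"
      using n c by (intro convexD[OF assms x recession_cone_iterate[OF d x]]) auto
    also have "(1 - c / n) *\<^sub>R x + (c / n) *\<^sub>R (x + real n *\<^sub>R d) = x + c *\<^sub>R d"
      using n c by (simp add: algebra_simps)
    finally show "x + c *\<^sub>R d \<in> S" .
  qed
qed

text \<open>Segments from \<open>x\<close> to ever farther points of the ray lie in
  \<open>S\<close>. Their points at parameter \<open>1 / t\<close> tend to \<open>x + d\<close>, and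
  closedness keeps the limit in \<open>S\<close>.\<close>

lemma ray_in_recession_cone:
  fixes S :: "'a::real_normed_vector set"
  assumes "convex S" "closed S" and unb: "\<not> bdd_above {t. p + t *\<^sub>R d \<in> S}"
  shows "d \<in> recession_cone S"
  unfolding recession_cone_def
proof (intro CollectI ballI)
  fix x assume x: "x \<in> S"
  have "\<exists>t. p + t *\<^sub>R d \<in> S \<and> real (Suc n) < t" for n
    using unb by (auto simp: bdd_above_def not_le)
  then obtain t where t: "\<And>n. p + t n *\<^sub>R d \<in> S" "\<And>n. real (Suc n) < t n" by metis
  have t1: "1 < t n" for n using t(2)[of n] by simp
  have "real n \<le> t n" for n using t(2)[of n] by simp
  then have "filterlim t at_top sequentially"
    by (intro filterlim_at_top_mono[OF filterlim_real_sequentially] always_eventually) blast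
  then have lim: "(\<lambda>n. x + d + inverse (t n) *\<^sub>R (p - x)) \<longlonglongrightarrow> x + d + 0 *\<^sub>R (p - x)"
    by (intro tendsto_intros tendsto_inverse_0_at_top)
  have mem: "x + d + inverse (t n) *\<^sub>R (p - x) \<in> S" for n
  proof -
    have "(1 - inverse (t n)) *\<^sub>R x + inverse (t n) *\<^sub>R (p + t n *\<^sub>R d) \<in> S"
      using t1[of n] by (intro convexD[OF assms(1) x t(1)]) (auto simp: field_simps)
    also have "(1 - inverse (t n)) *\<^sub>R x + inverse (t n) *\<^sub>R (p + t n *\<^sub>R d)
        = x + d + inverse (t n) *\<^sub>R (p - x)"
      using t1[of n] by (simp add: algebra_simps)
    finally show ?thesis .
  qed
  show "x + d \<in> S"
    using closed_sequentially[OF assms(2) mem lim] by simp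
qed

lemma inner_transpose: "transpose X \<bullet> Y = (X::real^'m^'n) \<bullet> transpose Y"
  unfolding inner_vec_def by (simp add: transpose_def) (rule sum.swap)

text \<open>The test matrices need not be symmetric. Both signs of the skew part of \<open>U\<close>
  are among them, since its quadratic form is zero, and this forces \<open>U\<close> to be
  symmetric.\<close>

lemma inner_self_dual_cone_imp_psd:
  fixes U :: "real^'l^'l"
  assumes "\<And>X. (\<And>z. 0 \<le> X \<bullet> outer_square z) \<Longrightarrow> 0 \<le> U \<bullet> X"
  shows "psd U"
proof -
  let ?E = "U - transpose U"
  have t: "transpose (outer_square z) = outer_square z" for z :: "real^'l"
    by (simp add: outer_square_def transpose_def mult.commute)
  have E: "?E \<bullet> outer_square z = 0" for z
    by (simp add: inner_diff_left inner_transpose t)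
  then have "0 \<le> U \<bullet> ?E" "0 \<le> U \<bullet> (- ?E)"
    by (intro assms; simp del: minus_diff_eq)+
  then have "U \<bullet> ?E = 0" by (simp add: inner_diff_right)
  moreover have "?E \<bullet> ?E = 2 * (U \<bullet> ?E)"
    by (simp add: inner_diff_right inner_diff_left inner_transpose inner_commute)
  ultimately have "?E = 0" by simp
  then have "sym_mat U" by (simp add: sym_mat_def)
  moreover have "0 \<le> U \<bullet> outer_square z" for z
    by (rule assms) (simp add: outer_square_inner_outer_square)
  ultimately show ?thesis by (simp add: psd_iff)
qed

lemma P2_feasible_set_eq:
  "{t. \<exists>x y. P2_feasible A m B A0 xbar d x y t} = {t. xbar + t *\<^sub>R d \<in> shadow A m B A0}"
  by (auto simp: P2_feasible_def shadow_def)

section \<open>Conic duality for a strictly feasible shadow\<close>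

locale strictly_feasible_shadow =
  fixes A :: "'n::finite \<Rightarrow> real^'l^'l" and m :: nat and B :: "nat \<Rightarrow> real^'l^'l"
    and A0 :: "real^'l^'l" and xbar :: "real^'n"
  assumes sym_A0: "sym_mat A0" and sym_A: "\<And>i. sym_mat (A i)"
    and sym_B: "\<And>j. j \<in> {1..m} \<Longrightarrow> sym_mat (B j)"
    and slater: "\<exists>ybar. pos_def (lin_x A xbar + lin_y m B ybar + A0)"
    and closed_shadow: "closed (shadow A m B A0)"
begin

abbreviation "S \<equiv> shadow A m B A0"
abbreviation "K \<equiv> recession_cone S"

lemma xbar_in_S: "xbar \<in> S"
  using slater by (auto simp: shadow_def intro: pos_def_imp_psd)

lemma convex_cone_K: "convex_cone K"
  by (intro convex_cone_recession_cone convex_shadow)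

lemma P2_unbounded_imp_K: "P2_unbounded A m B A0 xbar d \<Longrightarrow> d \<in> K"
  unfolding P2_unbounded_def P2_feasible_set_eq
  by (rule ray_in_recession_cone[OF convex_shadow closed_shadow])

text \<open>The vector \<open>w\<close> is a function of \<open>U\<close>, so the dual problem may
  be treated as a problem in \<open>U\<close> alone.\<close>

lemma D2_feasible_iff:
  "D2_feasible A m B d U w \<longleftrightarrow>
    psd U \<and> (\<forall>j\<in>{1..m}. B j \<bullet> U = 0) \<and> lin_x A d \<bullet> U = - 1 \<and> w = (\<chi> i. - (A i \<bullet> U))"
proof (cases "psd U")
  case True
  then have "mat_dot X U = X \<bullet> U" for X
    by (simp add: mat_dot_eq_inner psd_def)
  moreover have "lin_x A d \<bullet> U = - (d \<bullet> w)" if "\<And>i. A i \<bullet> U = - (w $ i)"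
    by (simp add: lin_x_inner that inner_real_vec[of d w] sum_negf)
  ultimately show ?thesis
    using True by (auto simp: D2_feasible_def vec_eq_iff)
qed (simp add: D2_feasible_def)

text \<open>Weak duality: two psd matrices pair nonnegatively, and the \<open>y\<close>-part is
  annihilated by \<open>U\<close>.\<close>

lemma D2_feasible_inner_S:
  assumes f: "D2_feasible A m B d U w" and x: "x \<in> S"
  shows "w \<bullet> x \<le> A0 \<bullet> U"
proof -
  obtain y where y: "psd (lin_x A x + lin_y m B y + A0)" using x by (auto simp: shadow_def)
  have "w $ i = - (A i \<bullet> U)" for i
    using f by (simp add: D2_feasible_iff)
  then have "lin_x A x \<bullet> U = - (w \<bullet> x)"
    by (simp add: lin_x_inner inner_real_vec[of w x] sum_negf mult.commute)
  moreover have "lin_y m B y \<bullet> U = 0"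
    using f by (simp add: D2_feasible_iff lin_y_inner)
  ultimately show ?thesis
    using psd_inner_nonneg[OF y, of U] f by (simp add: D2_feasible_iff inner_add_left)
qed

text \<open>Since \<open>w\<close> is bounded above on \<open>S\<close>, it cannot increase along a
  ray from \<open>xbar\<close> that stays in \<open>S\<close>.\<close>

lemma D2_feasible_inner_K:
  assumes f: "D2_feasible A m B d U w" and e: "e \<in> K"
  shows "w \<bullet> e \<le> 0"
proof (rule ccontr)
  assume "\<not> w \<bullet> e \<le> 0"
  then obtain n :: nat where "A0 \<bullet> U - w \<bullet> xbar < real n * (w \<bullet> e)"
    using ex_less_of_nat_mult[of "w \<bullet> e"] by auto
  with D2_feasible_inner_S[OF f recession_cone_iterate[OF e xbar_in_S, of n]] show False
    by (simp add: inner_add_right)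
qed

text \<open>On matrices orthogonal to every \<open>B j\<close> the dual objective agrees with the
  pairing with the Slater matrix, and so is coercive.\<close>

lemma slater_inner:
  obtains c where "c > 0"
    "\<And>U. psd U \<Longrightarrow> (\<And>j. j \<in> {1..m} \<Longrightarrow> B j \<bullet> U = 0) \<Longrightarrow> c * norm U \<le> (lin_x A xbar + A0) \<bullet> U"
proof -
  obtain y where "pos_def (lin_x A xbar + lin_y m B y + A0)" using slater by blast
  then obtain c where c: "c > 0"
    "\<And>U. psd U \<Longrightarrow> c * norm U \<le> (lin_x A xbar + lin_y m B y + A0) \<bullet> U"
    by (rule pos_def_inner_ge) blast
  show thesis
  proof (rule that[OF c(1)])
    fix U :: "real^'l^'l" assume "psd U" "\<And>j. j \<in> {1..m} \<Longrightarrow> B j \<bullet> U = 0"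
    then show "c * norm U \<le> (lin_x A xbar + A0) \<bullet> U"
      using c(2)[of U] by (simp add: inner_add_left lin_y_inner)
  qed
qed

text \<open>Farkas-type argument: separate the cone of matrices with nonnegative quadratic form (not
  required to be symmetric, so that it is full-dimensional and the separating functional is
  automatically symmetric) from the slice \<open>t \<ge> t1\<close> of the matrix pencil.\<close>

lemma ex_D2_feasible:
  assumes "\<not> P2_unbounded A m B A0 xbar d"
  shows "\<exists>U w. D2_feasible A m B d U w"
proof -
  let ?N = "lin_x A xbar + A0" and ?D = "lin_x A d"
  obtain b0 where b0: "\<And>t. xbar + t *\<^sub>R d \<in> S \<Longrightarrow> t \<le> b0"
    using assms by (auto simp: P2_unbounded_def P2_feasible_set_eq bdd_above_def)
  have "0 \<le> b0" using b0[of 0] xbar_in_S by simp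
  \<comment> \<open>One step past the bound on feasible \<open>t\<close>, so that the slice misses
    the cone \<open>P\<close>; positivity of \<open>t1\<close> later fixes the sign of
    \<open>?D \<bullet> U\<close>.\<close>
  define t1 where "t1 = b0 + 1"
  have t1: "t1 > 0" using \<open>0 \<le> b0\<close> by (simp add: t1_def)
  define T where "T = {X. \<exists>t y. t1 \<le> t \<and> X = ?N + t *\<^sub>R ?D + lin_y m B y}"
  define P where "P = {X::real^'l^'l. \<forall>z. 0 \<le> X \<bullet> outer_square z}"
  have "convex P"
    unfolding P_def by (rule convexI) (auto simp: inner_add_left)
  have "convex T"
  proof (rule convexI)
    fix X X' and u v :: real
    assume "X \<in> T" "X' \<in> T" and uv: "0 \<le> u" "0 \<le> v" "u + v = 1"
    then obtain t y t' y' where t: "t1 \<le> t" "t1 \<le> t'"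
      and X: "X = ?N + t *\<^sub>R ?D + lin_y m B y" "X' = ?N + t' *\<^sub>R ?D + lin_y m B y'"
      by (auto simp: T_def)
    have "u *\<^sub>R X + v *\<^sub>R X'
        = (u *\<^sub>R ?N + v *\<^sub>R ?N) + (u * t + v * t') *\<^sub>R ?D + lin_y m B (\<lambda>j. u * y j + v * y' j)"
      unfolding X lin_y_add lin_y_scaleR by (simp add: algebra_simps)
    also have "u *\<^sub>R ?N + v *\<^sub>R ?N = ?N"
      using uv by (metis scaleR_left_distrib scaleR_one)
    finally have "u *\<^sub>R X + v *\<^sub>R X'
        = ?N + (u * t + v * t') *\<^sub>R ?D + lin_y m B (\<lambda>j. u * y j + v * y' j)" .
    moreover have "t1 \<le> u * t + v * t'"
      using convex_bound_le[of "- t" "- t1" "- t'" u v] t uv by simp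
    ultimately show "u *\<^sub>R X + v *\<^sub>R X' \<in> T" by (auto simp: T_def)
  qed
  have "T \<inter> P = {}"
  proof (rule ccontr)
    assume "T \<inter> P \<noteq> {}"
    then obtain t y where t: "t1 \<le> t" and P: "?N + t *\<^sub>R ?D + lin_y m B y \<in> P"
      by (auto simp: T_def)
    let ?X = "lin_x A (xbar + t *\<^sub>R d) + lin_y m B y + A0"
    have X: "?X = ?N + t *\<^sub>R ?D + lin_y m B y"
      by (simp add: lin_x_add lin_x_scaleR)
    have "sym_mat ?X"
      using sym_A0 sym_A sym_B by (simp add: sym_mat_nth lin_x_def lin_y_def)
    then have "psd ?X" using P unfolding X P_def psd_iff by simp
    then have "xbar + t *\<^sub>R d \<in> S" by (auto simp: shadow_def)
    with b0[of t] t show False by (simp add: t1_def)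
  qed
  moreover have "?N + t1 *\<^sub>R ?D + lin_y m B (\<lambda>_. 0) \<in> T" unfolding T_def by blast
  moreover have "0 \<in> P" by (simp add: P_def)
  ultimately obtain U b where U: "U \<noteq> 0" and UT: "\<And>X. X \<in> T \<Longrightarrow> U \<bullet> X \<le> b"
    and UP: "\<And>X. X \<in> P \<Longrightarrow> b \<le> U \<bullet> X"
    using separating_hyperplane_sets[OF \<open>convex T\<close> \<open>convex P\<close>] by blast
  have b: "b \<le> 0" using UP[OF \<open>0 \<in> P\<close>] by simp
  \<comment> \<open>A negative value of \<open>U\<close> on \<open>P\<close> could be scaled below
    \<open>b\<close>, because \<open>P\<close> is a cone.\<close>
  have "psd U"
  proof (rule inner_self_dual_cone_imp_psd, rule ccontr)
    fix X :: "real^'l^'l" assume X: "\<And>z. 0 \<le> X \<bullet> outer_square z" and "\<not> 0 \<le> U \<bullet> X"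
    then obtain n :: nat where "- b < real n * - (U \<bullet> X)"
      using ex_less_of_nat_mult[of "- (U \<bullet> X)" "- b"] by auto
    moreover have "real n *\<^sub>R X \<in> P" using X by (simp add: P_def)
    ultimately show False using UP[of "real n *\<^sub>R X"] by simp
  qed
  have le: "?N \<bullet> U + t1 * (?D \<bullet> U) + lin_y m B y \<bullet> U \<le> 0" for y
  proof -
    have "U \<bullet> (?N + t1 *\<^sub>R ?D + lin_y m B y) \<le> b" by (rule UT) (auto simp: T_def)
    then show ?thesis using b by (simp add: inner_add_right inner_commute inner_add_left)
  qed
  \<comment> \<open>The bound \<open>le\<close> holds for every \<open>y\<close>, so no
    \<open>B j\<close> can contribute: otherwise \<open>s\<close> would raise the left side to
    1.\<close>
  have BU: "B j \<bullet> U = 0" if j: "j \<in> {1..m}" for j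
  proof (rule ccontr)
    assume nz: "B j \<bullet> U \<noteq> 0"
    let ?r = "?N \<bullet> U + t1 * (?D \<bullet> U)"
    define s where "s = (1 - ?r) / (B j \<bullet> U)"
    have "lin_y m B (\<lambda>i. if i = j then s else 0) = s *\<^sub>R B j"
      using j by (simp add: lin_y_def if_distribR if_distrib[of "\<lambda>c. c *\<^sub>R _"] cong: if_cong)
    then have "?r + s * (B j \<bullet> U) \<le> 0"
      using le[of "\<lambda>i. if i = j then s else 0"] by simp
    then show False using nz by (simp add: s_def)
  qed
  \<comment> \<open>Strict feasibility excludes the degenerate case
    \<open>?D \<bullet> U = 0\<close>, so \<open>U\<close> can be rescaled to meet the dual
    normalisation.\<close>
  obtain c where "c > 0" "c * norm U \<le> ?N \<bullet> U"
    using slater_inner \<open>psd U\<close> BU by metis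
  moreover have "c * norm U > 0" using U \<open>c > 0\<close> by simp
  ultimately have "?N \<bullet> U > 0" by linarith
  then have "t1 * (?D \<bullet> U) < 0" using le[of "\<lambda>_. 0"] by (simp add: lin_y_def)
  then have D: "?D \<bullet> U < 0" using t1 by (simp add: mult_less_0_iff)
  let ?U = "(1 / - (?D \<bullet> U)) *\<^sub>R U"
  have "psd ?U" using psd_scaleR[OF \<open>psd U\<close>, of "1 / - (?D \<bullet> U)"] D by simp
  then have "D2_feasible A m B d ?U (\<chi> i. - (A i \<bullet> ?U))"
    unfolding D2_feasible_iff using BU D by auto
  then show ?thesis by blast
qed

text \<open>The feasible matrices with objective at most that of \<open>U0\<close> form a compact
  set, on which the minimum is attained.\<close>

lemma ex_D2_solution:
  assumes "\<not> P2_unbounded A m B A0 xbar d"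
  shows "\<exists>U w. D2_solution A m B A0 xbar d U w"
proof -
  let ?N = "lin_x A xbar + A0"
  obtain U0 w0 where U0: "D2_feasible A m B d U0 w0" using ex_D2_feasible[OF assms] by blast
  define F where "F = {U. psd U} \<inter> {U. lin_x A d \<bullet> U = - 1} \<inter> (\<Inter>j\<in>{1..m}. {U. B j \<bullet> U = 0})"
  have F: "D2_feasible A m B d U w \<longleftrightarrow> U \<in> F \<and> w = (\<chi> i. - (A i \<bullet> U))" for U w
    by (auto simp: D2_feasible_iff F_def)
  let ?L = "F \<inter> {U. ?N \<bullet> U \<le> ?N \<bullet> U0}"
  obtain c where c: "c > 0"
    "\<And>U. psd U \<Longrightarrow> (\<And>j. j \<in> {1..m} \<Longrightarrow> B j \<bullet> U = 0) \<Longrightarrow> c * norm U \<le> ?N \<bullet> U"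
    using slater_inner by blast
  have "norm U \<le> (?N \<bullet> U0) / c" if "U \<in> ?L" for U
  proof -
    have "c * norm U \<le> ?N \<bullet> U" by (rule c(2)) (use that in \<open>auto simp: F_def\<close>)
    also have "\<dots> \<le> ?N \<bullet> U0" using that by simp
    finally show ?thesis using c(1) by (simp add: field_simps)
  qed
  then have "bounded ?L" unfolding bounded_iff by blast
  moreover have "closed ?L"
    unfolding F_def
    by (intro closed_Int closed_psd closed_INT ballI closed_Collect_eq closed_Collect_le
        continuous_intros)
  ultimately have "compact ?L" by (simp add: compact_eq_bounded_closed)
  moreover have "U0 \<in> ?L" using U0 by (simp add: F)
  moreover have "continuous_on ?L (\<lambda>U. ?N \<bullet> U)" by (intro continuous_intros)
  ultimately obtain U where U: "U \<in> ?L" and min: "\<And>U'. U' \<in> ?L \<Longrightarrow> ?N \<bullet> U \<le> ?N \<bullet> U'"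
    using continuous_attains_inf[of ?L "\<lambda>U. ?N \<bullet> U"] by blast
  have "?N \<bullet> U \<le> ?N \<bullet> U'" if "U' \<in> F" for U'
    using min[of U'] U that by force
  moreover have "mat_dot ?N V = ?N \<bullet> V" if "V \<in> F" for V
    using that by (simp add: F_def mat_dot_eq_inner psd_def)
  ultimately have "D2_solution A m B A0 xbar d U (\<chi> i. - (A i \<bullet> U))"
    using U unfolding D2_solution_def F by auto
  then show ?thesis by blast
qed

text \<open>If \<open>- dbar\<close> were in \<open>K\<close>, adding it to a ball around
  \<open>dbar\<close> would put a ball around 0 into \<open>K\<close>, making \<open>K\<close> and
  then \<open>S\<close> the whole space. This secures the first dual solution.\<close>

lemma P2_bounded_uminus_interior:
  assumes "S \<noteq> UNIV" "dbar \<in> interior K"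
  shows "\<not> P2_unbounded A m B A0 xbar (- dbar)"
proof
  assume "P2_unbounded A m B A0 xbar (- dbar)"
  then have neg: "- dbar \<in> K" by (rule P2_unbounded_imp_K)
  obtain r where r: "r > 0" "cball dbar r \<subseteq> K"
    using assms(2) by (auto simp: mem_interior_cball)
  have K: "x \<in> K" for x
  proof (cases "x = 0")
    case True
    then show ?thesis using convex_cone_K by (simp add: convex_cone_contains_0)
  next
    case False
    have "dbar + (r / norm x) *\<^sub>R x \<in> K"
      using r by (intro subsetD[OF r(2)]) (simp add: dist_norm)
    from convex_cone_add[OF convex_cone_K this neg]
    have "(r / norm x) *\<^sub>R x \<in> K" by simp
    from convex_cone_scaleR[OF convex_cone_K _ this, of "norm x / r"]
    show ?thesis using r False by simp
  qed
  have "x \<in> S" for x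
    using K[of "x - xbar"] xbar_in_S by (auto simp: recession_cone_def)
  with assms(1) show False by blast
qed

end


section \<open>Approximation of cones and termination of the algorithm\<close>

text \<open>Takes for \<open>q\<close> the projection of \<open>x\<close> onto the ray through
  \<open>p\<close>, or 0 if the angle is not acute. The norm bound is needed because
  \<open>cone_dist\<close> compares cones inside the unit ball.\<close>

lemma ray_point_approx:
  fixes x p :: "'a::real_inner"
  assumes "convex_cone C" "p \<in> C"
  shows "\<exists>q\<in>C. norm q \<le> norm x \<and> norm (x - q) \<le> norm (x - p)"
proof (cases "0 < x \<bullet> p")
  case False
  have "2 * (x \<bullet> p) \<le> p \<bullet> p"
    using False inner_ge_zero[of p] by linarith
  then have "(norm x)\<^sup>2 \<le> (norm (x - p))\<^sup>2"
    unfolding power2_norm_eq_inner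
    by (simp add: inner_diff_left inner_diff_right inner_commute[of p x])
  then have "norm x \<le> norm (x - p)" by (rule power2_le_imp_le) simp
  then show ?thesis
    using convex_cone_contains_0[OF assms(1)] by (intro bexI[of _ 0]) simp_all
next
  case True
  then have "p \<noteq> 0" by auto
  then have pp: "0 < p \<bullet> p" by simp
  define s where "s = (x \<bullet> p) / (p \<bullet> p)"
  have s: "s * (p \<bullet> p) = x \<bullet> p" using pp by (simp add: s_def)
  have "0 \<le> s" using True pp by (simp add: s_def)
  then have "s *\<^sub>R p \<in> C" using assms by (simp add: convex_cone_scaleR)
  moreover have "norm (s *\<^sub>R p) \<le> norm x"
  proof (rule power2_le_imp_le)
    have "(norm x)\<^sup>2 - (norm (s *\<^sub>R p))\<^sup>2 = (norm (x - s *\<^sub>R p))\<^sup>2 + 2 * s * (x \<bullet> p - s * (p \<bullet> p))"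
      unfolding power2_norm_eq_inner
      by (simp add: inner_diff_left inner_diff_right inner_commute[of p x] algebra_simps)
    moreover have "2 * s * (x \<bullet> p - s * (p \<bullet> p)) = 0" by (simp only: s) simp
    ultimately show "(norm (s *\<^sub>R p))\<^sup>2 \<le> (norm x)\<^sup>2"
      using zero_le_power2[of "norm (x - s *\<^sub>R p)"] by linarith
  qed simp
  moreover have "norm (x - s *\<^sub>R p) \<le> norm (x - p)"
  proof (rule power2_le_imp_le)
    have "(norm (x - p))\<^sup>2 - (norm (x - s *\<^sub>R p))\<^sup>2
        = (1 - s)\<^sup>2 * (p \<bullet> p) + 2 * (1 - s) * (s * (p \<bullet> p) - x \<bullet> p)"
      unfolding power2_norm_eq_inner
      by (simp add: inner_diff_left inner_diff_right inner_commute[of p x] algebra_simps power2_eq_square)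
    moreover have "0 \<le> (1 - s)\<^sup>2 * (p \<bullet> p)" by simp
    moreover have "2 * (1 - s) * (s * (p \<bullet> p) - x \<bullet> p) = 0" by (simp only: s) simp
    ultimately show "(norm (x - s *\<^sub>R p))\<^sup>2 \<le> (norm (x - p))\<^sup>2" by linarith
  qed simp
  ultimately show ?thesis by blast
qed

lemma hausdorff_dist_le:
  assumes "C1 \<noteq> {}" "C2 \<noteq> {}"
    and "\<And>x. x \<in> C1 \<Longrightarrow> \<exists>y\<in>C2. norm (x - y) \<le> e" "\<And>y. y \<in> C2 \<Longrightarrow> \<exists>x\<in>C1. norm (y - x) \<le> e"
  shows "hausdorff_dist C1 C2 \<le> e"
proof -
  have bdd: "bdd_below ((\<lambda>y. norm (x - y)) ` C)" for x :: 'a and C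
    by (intro bdd_belowI2[of _ 0]) simp
  have "(SUP x\<in>C1. INF y\<in>C2. norm (x - y)) \<le> e"
    using assms(1,3) by (intro cSUP_least) (auto intro: cINF_lower2[OF bdd])
  moreover have "(SUP y\<in>C2. INF x\<in>C1. norm (y - x)) \<le> e"
    using assms(2,4) by (intro cSUP_least) (auto intro: cINF_lower2[OF bdd])
  ultimately show ?thesis by (simp add: hausdorff_dist_def)
qed

lemma infnorm_ball_eq_cbox: "{x::'a::euclidean_space. infnorm x \<le> r} = cbox (- r *\<^sub>R One) (r *\<^sub>R One)"
  by (auto simp: infnorm_Max mem_box abs_le_iff minus_le_iff)

lemma compact_infnorm_ball: "compact {x::'a::euclidean_space. infnorm x \<le> r}"
  by (simp only: infnorm_ball_eq_cbox compact_cbox)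

lemma polyhedron_infnorm_ball: "polyhedron {x::'a::euclidean_space. infnorm x \<le> r}"
  by (simp only: infnorm_ball_eq_cbox polyhedron_interval)

section \<open>Packing numbers of subsets of compact sets\<close>

definition packing_number :: "real \<Rightarrow> 'a::metric_space set \<Rightarrow> nat" where
  "packing_number r X =
    Max {card F | F. finite F \<and> F \<subseteq> X \<and> pairwise (\<lambda>x y. r \<le> dist x y) F}"

text \<open>Pigeonhole: among finitely many balls of radius \<open>r / 2\<close> covering
  \<open>Y\<close>, each holds at most one point of an \<open>r\<close>-separated set. This makes
  the \<open>Max\<close> in \<open>packing_number\<close> meaningful.\<close>

lemma finite_packing_cards:
  fixes X :: "'a::metric_space set"
  assumes "compact Y" "X \<subseteq> Y" "0 < r"
  shows "finite {card F | F. finite F \<and> F \<subseteq> X \<and> pairwise (\<lambda>x y. r \<le> dist x y) F}"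
proof -
  obtain k where k: "finite k" "Y \<subseteq> (\<Union>x\<in>k. ball x (r / 2))"
    using assms(1,3) unfolding compact_eq_totally_bounded by (meson half_gt_zero)
  have "card F \<le> card k" if F: "F \<subseteq> X" "pairwise (\<lambda>x y. r \<le> dist x y) F" for F
  proof -
    have "\<forall>x\<in>F. \<exists>c\<in>k. dist c x < r / 2" using k(2) F(1) assms(2) by fastforce
    then obtain c where c: "\<And>x. x \<in> F \<Longrightarrow> c x \<in> k \<and> dist (c x) x < r / 2" by metis
    have "inj_on c F"
    proof (rule inj_onI, rule ccontr)
      fix x y assume xy: "x \<in> F" "y \<in> F" "c x = c y" "x \<noteq> y"
      then have "r \<le> dist x y" using F(2) by (auto simp: pairwise_def)
      moreover have "dist x y \<le> dist (c x) x + dist (c y) y"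
        using xy(3) dist_triangle3[of x y "c x"] by simp
      ultimately show False using c[OF xy(1)] c[OF xy(2)] by linarith
    qed
    then show ?thesis using c k(1) by (intro card_inj_on_le[of c]) auto
  qed
  then show ?thesis
    by (intro finite_subset[OF _ finite_atMost[of "card k"]]) auto
qed

lemma card_le_packing_number:
  assumes "compact Y" "X \<subseteq> Y" "0 < r" "finite F" "F \<subseteq> X" "pairwise (\<lambda>x y. r \<le> dist x y) F"
  shows "card F \<le> packing_number r X"
  unfolding packing_number_def
  using assms by (intro Max_ge finite_packing_cards[OF assms(1-3)]) auto

lemma packing_number_attained:
  assumes "compact Y" "X \<subseteq> Y" "0 < r"
  obtains F where "finite F" "F \<subseteq> X" "pairwise (\<lambda>x y. r \<le> dist x y) F"
    "card F = packing_number r X"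
proof -
  have "packing_number r X
      \<in> {card F | F. finite F \<and> F \<subseteq> X \<and> pairwise (\<lambda>x y. r \<le> dist x y) F}"
    unfolding packing_number_def
    by (intro Max_in finite_packing_cards[OF assms]) (auto intro!: exI[of _ "{}"])
  then show thesis using that by auto
qed

lemma packing_number_mono:
  assumes "compact Y" "X' \<subseteq> X" "X \<subseteq> Y" "0 < r"
  shows "packing_number r X' \<le> packing_number r X"
proof -
  obtain F where "finite F" "F \<subseteq> X'" "pairwise (\<lambda>x y. r \<le> dist x y) F"
    "card F = packing_number r X'"
    using packing_number_attained[of Y X' r] assms by blast
  then show ?thesis using card_le_packing_number[of Y X r F] assms by auto
qed

text \<open>A largest packing of \<open>X'\<close> can be enlarged by the point
  \<open>v\<close>.\<close>

lemma packing_number_less: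
  assumes "compact Y" "X' \<subseteq> X" "X \<subseteq> Y" "0 < r" "v \<in> X" "\<And>x. x \<in> X' \<Longrightarrow> r \<le> dist v x"
  shows "packing_number r X' < packing_number r X"
proof -
  obtain F where F: "finite F" "F \<subseteq> X'" "pairwise (\<lambda>x y. r \<le> dist x y) F"
    "card F = packing_number r X'"
    using packing_number_attained[of Y X' r] assms by blast
  have "v \<notin> F" using F(2) assms(4,6) by fastforce
  have "card (insert v F) \<le> packing_number r X"
  proof (rule card_le_packing_number[OF assms(1,3,4)])
    show "pairwise (\<lambda>x y. r \<le> dist x y) (insert v F)"
      using F assms(6) by (auto simp: pairwise_insert dist_commute)
  qed (use F assms in auto)
  then show ?thesis using F \<open>v \<notin> F\<close> by simp
qed

section \<open>Vertices of the truncated outer cone\<close>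

lemma finite_nonzero_vertices: "polyhedron C \<Longrightarrow> finite (nonzero_vertices C)"
proof -
  assume "polyhedron C"
  then have "polyhedron (C \<inter> {x. infnorm x \<le> 1})"
    by (intro polyhedron_Int polyhedron_infnorm_ball)
  then have "finite {v. v extreme_point_of {x \<in> C. infnorm x \<le> 1}}"
    by (intro finite_polyhedron_extreme_points) (simp add: Int_def)
  then show ?thesis
    by (rule rev_finite_subset) (auto simp: nonzero_vertices_def)
qed

lemma nonzero_verticesD: "v \<in> nonzero_vertices C \<Longrightarrow> v \<in> C \<and> infnorm v \<le> 1"
  by (auto simp: nonzero_vertices_def extreme_point_of_def)

lemma polyhedral_cone_halfspace_le: "polyhedral_cone (halfspace_le w 0)"
  by (simp add: polyhedral_cone_def halfspace_le_def polyhedron_halfspace_le convex_cone_halfspace_le)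

lemma polyhedral_cone_Int: "polyhedral_cone C \<Longrightarrow> polyhedral_cone D \<Longrightarrow> polyhedral_cone (C \<inter> D)"
  unfolding polyhedral_cone_def convex_cone_iff by auto

text \<open>Each increment of \<open>k\<close> halves the distance from the search direction to
  \<open>v\<close>, and \<open>num_dirs\<close> is large enough to bring it down to
  \<open>e\<close>. If there are no directions, \<open>dbar\<close> itself is close enough.\<close>

lemma search_dir_approx:
  assumes C: "dbar \<in> C" "\<And>j. 1 \<le> j \<Longrightarrow> j \<le> num_dirs e dbar v \<Longrightarrow> search_dir dbar v j \<in> C"
    and e: "0 < e"
  shows "\<exists>p\<in>C. norm (v - p) \<le> e"
proof (cases "v = dbar")
  case True
  then show ?thesis using C(1) e by (intro bexI[of _ dbar]) auto
next
  case False
  let ?N = "num_dirs e dbar v" and ?q = "norm (v - dbar) / e"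
  have q: "0 < ?q" using False e by simp
  have "log 2 ?q \<le> real ?N"
    using False by (simp add: num_dirs_def) linarith
  then have "?q \<le> 2 powr real ?N" using q by (simp add: log_le_iff)
  then have le: "norm (v - dbar) \<le> e * 2 ^ ?N" using e by (simp add: powr_realpow field_simps)
  show ?thesis
  proof (cases "?N = 0")
    case True
    then show ?thesis using C(1) le by (intro bexI[of _ dbar]) auto
  next
    case False
    have "v - search_dir dbar v ?N = (1 / 2 ^ ?N) *\<^sub>R (v - dbar)"
      by (simp add: search_dir_def diff_divide_distrib algebra_simps)
    then have "norm (v - search_dir dbar v ?N) = norm ((1 / 2 ^ ?N) *\<^sub>R (v - dbar))"
      by (simp only:)
    also have "\<dots> = norm (v - dbar) / 2 ^ ?N" by simp
    also have "\<dots> \<le> e" using le by (simp add: divide_le_eq)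
    finally show ?thesis using C(2)[of ?N] False by auto
  qed
qed

text \<open>The points within \<open>e\<close> of \<open>D\<close> form a convex set containing all
  extreme points of the truncated cone, hence their convex hull.\<close>

lemma vertices_approx_imp_cone_approx:
  assumes C: "polyhedral_cone C" and D: "convex_cone D"
    and v: "\<And>v. v \<in> nonzero_vertices C \<Longrightarrow> \<exists>p\<in>D. norm (v - p) \<le> e" and e: "0 \<le> e"
    and x: "x \<in> C \<inter> cball 0 1"
  shows "\<exists>p\<in>D \<inter> cball 0 1. norm (x - p) \<le> e"
proof -
  let ?P = "{x \<in> C. infnorm x \<le> 1}"
  define Q where "Q = {x. \<exists>p\<in>D. norm (x - p) \<le> e}"
  have P: "?P = C \<inter> {x. infnorm x \<le> 1}" by auto
  have "convex Q"
  proof (rule convexI)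
    fix x y and s t :: real assume "x \<in> Q" "y \<in> Q" and st: "0 \<le> s" "0 \<le> t" "s + t = 1"
    then obtain p q where p: "p \<in> D" "norm (x - p) \<le> e" and q: "q \<in> D" "norm (y - q) \<le> e"
      by (auto simp: Q_def)
    have "s *\<^sub>R p + t *\<^sub>R q \<in> D"
      using p q st D by (intro convex_cone_add convex_cone_scaleR)
    moreover have "norm ((s *\<^sub>R x + t *\<^sub>R y) - (s *\<^sub>R p + t *\<^sub>R q)) \<le> e"
    proof -
      have "(s *\<^sub>R x + t *\<^sub>R y) - (s *\<^sub>R p + t *\<^sub>R q) = s *\<^sub>R (x - p) + t *\<^sub>R (y - q)"
        by (simp add: algebra_simps)
      also have "norm \<dots> \<le> s * norm (x - p) + t * norm (y - q)"
        using norm_triangle_ineq[of "s *\<^sub>R (x - p)" "t *\<^sub>R (y - q)"] st by simp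
      also have "\<dots> \<le> e" by (rule convex_bound_le) (use p q st in auto)
      finally show ?thesis .
    qed
    ultimately show "s *\<^sub>R x + t *\<^sub>R y \<in> Q" by (auto simp: Q_def)
  qed
  have "closed C" using C by (simp add: polyhedral_cone_def polyhedron_imp_closed)
  then have "compact ?P"
    unfolding P by (intro closed_Int_compact compact_infnorm_ball)
  moreover have "convex ?P"
    unfolding P using C
    by (intro convex_Int polyhedron_imp_convex polyhedron_infnorm_ball) (simp add: polyhedral_cone_def)
  ultimately have "?P = convex hull {v. v extreme_point_of ?P}"
    by (rule Krein_Milman_Minkowski)
  also have "\<dots> \<subseteq> Q"
  proof (rule hull_minimal)
    show "{v. v extreme_point_of ?P} \<subseteq> Q"
    proof
      fix u assume u: "u \<in> {v. v extreme_point_of ?P}"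
      show "u \<in> Q"
      proof (cases "u = 0")
        \<comment> \<open>The origin is left out of \<open>nonzero_vertices\<close>, but it belongs
          to \<open>D\<close>.\<close>
        case True
        then show ?thesis
          using convex_cone_contains_0[OF D] e by (auto simp: Q_def intro: bexI[of _ 0])
      next
        case False
        then show ?thesis using u v[of u] by (simp add: nonzero_vertices_def Q_def)
      qed
    qed
  qed fact
  \<comment> \<open>The Euclidean unit ball lies inside the cube that truncates
    \<open>C\<close>.\<close>
  finally have "x \<in> Q" using x infnorm_le_norm[of x] by (force simp: mem_cball_0)
  then obtain p where "p \<in> D" "norm (x - p) \<le> e" by (auto simp: Q_def)
  then obtain q where "q \<in> D" "norm q \<le> norm x" "norm (x - q) \<le> e"
    using ray_point_approx[OF D, of p x] by force
  then show ?thesis using x by (intro bexI[of _ q]) auto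
qed

text \<open>Because \<open>K\<close> lies between \<open>D\<close> and \<open>C\<close>, the single
  estimate from \<open>C\<close> to \<open>D\<close> bounds both distances.\<close>

lemma cone_approximations:
  assumes "polyhedral_cone C" "polyhedral_cone D" "D \<subseteq> K" "K \<subseteq> C" "0 \<le> e"
    and "\<And>v. v \<in> nonzero_vertices C \<Longrightarrow> \<exists>p\<in>D. norm (v - p) \<le> e"
  shows "inner_approx e K D \<and> outer_approx e K C"
proof -
  have D: "convex_cone D" using assms(2) by (simp add: polyhedral_cone_def)
  have approx: "\<exists>p\<in>D \<inter> cball 0 1. norm (x - p) \<le> e" if "x \<in> C \<inter> cball 0 1" for x
    by (rule vertices_approx_imp_cone_approx[OF assms(1) D assms(6,5) that])
  have 0: "0 \<in> D \<inter> cball 0 1" using convex_cone_contains_0[OF D] by simp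
  have "cone_dist D K \<le> e" unfolding cone_dist_def
  proof (rule hausdorff_dist_le)
    fix x assume "x \<in> D \<inter> cball 0 1"
    then show "\<exists>y\<in>K \<inter> cball 0 1. norm (x - y) \<le> e"
      using assms(3,5) by (intro bexI[of _ x]) auto
  qed (use 0 assms(3,4) approx in blast)+
  moreover have "cone_dist C K \<le> e" unfolding cone_dist_def
  proof (rule hausdorff_dist_le)
    fix x assume "x \<in> K \<inter> cball 0 1"
    then show "\<exists>y\<in>C \<inter> cball 0 1. norm (x - y) \<le> e"
      using assms(4,5) by (intro bexI[of _ x]) auto
  next
    fix x assume "x \<in> C \<inter> cball 0 1"
    then show "\<exists>y\<in>K \<inter> cball 0 1. norm (x - y) \<le> e" using approx assms(3) by blast
  qed (use 0 assms(3,4) in blast)+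
  ultimately show ?thesis
    using assms by (simp add: inner_approx_def outer_approx_def)
qed

section \<open>Progress and invariants of the algorithm\<close>

locale alg2_input = strictly_feasible_shadow A m B A0 xbar
  for A :: "'n::finite \<Rightarrow> real^'l^'l" and m B A0 xbar +
  fixes dbar :: "real^'n" and \<epsilon> :: real
  assumes S_not_UNIV: "S \<noteq> UNIV" and dbar: "dbar \<in> interior K" and norm_dbar: "norm dbar \<le> 1"
    and eps: "0 < \<epsilon>"
begin

abbreviation "step \<equiv> alg2_step A m B A0 xbar dbar \<epsilon>"

text \<open>Only the initial step and a cut require a dual solution, and in both the primal problem
  is bounded.\<close>

lemma step_progress: "(\<exists>c'. step c c') \<or> (\<exists>I C. c = Returned I C)"
proof (cases c)
  case Start
  obtain U w where "D2_solution A m B A0 xbar (- dbar) U w"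
    using ex_D2_solution[OF P2_bounded_uminus_interior[OF S_not_UNIV dbar]] by blast
  then show ?thesis unfolding Start by (intro disjI1 exI) (rule alg2_step.init)
next
  case (Pass I C)
  show ?thesis unfolding Pass by (intro disjI1 exI) (rule alg2_step.begin_pass)
next
  case (Vertices I C stop V)
  consider v where "v \<in> V" | "V = {}" "stop = True" | "V = {}" "stop = False" by blast
  then show ?thesis
  proof cases
    case (1 v)
    show ?thesis unfolding Vertices by (intro disjI1 exI) (rule alg2_step.next_vertex[OF 1])
  next
    case 2
    show ?thesis unfolding Vertices 2 by (intro disjI1 exI) (rule alg2_step.end_pass_return)
  next
    case 3
    show ?thesis unfolding Vertices 3 by (intro disjI1 exI) (rule alg2_step.end_pass_repeat)
  qed
next
  case (Dirs I C stop V v k)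
  let ?d = "search_dir dbar v k"
  consider "k > num_dirs \<epsilon> dbar v" | "k \<le> num_dirs \<epsilon> dbar v" "?d \<in> I"
    | "k \<le> num_dirs \<epsilon> dbar v" "?d \<notin> I" "P2_unbounded A m B A0 xbar ?d"
    | "k \<le> num_dirs \<epsilon> dbar v" "?d \<notin> I" "\<not> P2_unbounded A m B A0 xbar ?d"
    by linarith
  then show ?thesis
  proof cases
    case 1
    show ?thesis unfolding Dirs by (intro disjI1 exI) (rule alg2_step.dirs_done[OF 1])
  next
    case 2
    show ?thesis unfolding Dirs by (intro disjI1 exI) (rule alg2_step.dir_known[OF 2])
  next
    case 3
    show ?thesis unfolding Dirs by (intro disjI1 exI) (rule alg2_step.dir_unbounded[OF 3])
  next
    case 4
    obtain U w where "D2_solution A m B A0 xbar ?d U w" using ex_D2_solution[OF 4(3)] by blast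
    from alg2_step.dir_cut[OF 4 this] show ?thesis unfolding Dirs by (intro disjI1 exI)
  qed
next
  case (Returned I C)
  then show ?thesis by blast
qed

text \<open>Finite generation of the inner cone is recorded because it survives each extension and
  gives polyhedrality on return.\<close>

definition approximants :: "(real^'n) set \<Rightarrow> (real^'n) set \<Rightarrow> bool" where
  "approximants I C \<longleftrightarrow> (\<exists>F. finite F \<and> I = convex_cone hull F) \<and> dbar \<in> I \<and> I \<subseteq> K \<and>
    polyhedral_cone C \<and> K \<subseteq> C"

definition searched :: "(real^'n) set \<Rightarrow> real^'n \<Rightarrow> bool" where
  "searched I v \<longleftrightarrow> (\<forall>j. 1 \<le> j \<and> j \<le> num_dirs \<epsilon> dbar v \<longrightarrow> search_dir dbar v j \<in> I)"

text \<open>Once a cut has been made in the current pass, the vertices waiting to be visited belong to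
  an older outer cone; only their boundedness is then retained.\<close>

fun alg2_inv :: "(real^'n) alg2_config \<Rightarrow> bool" where
  "alg2_inv Start \<longleftrightarrow> True"
| "alg2_inv (Pass I C) \<longleftrightarrow> approximants I C"
| "alg2_inv (Vertices I C stop V) \<longleftrightarrow> approximants I C \<and> finite V \<and> (\<forall>u\<in>V. infnorm u \<le> 1) \<and>
    (stop \<longrightarrow> V \<subseteq> C \<and> (\<forall>u\<in>nonzero_vertices C - V. searched I u))"
| "alg2_inv (Dirs I C stop V v k) \<longleftrightarrow> approximants I C \<and> finite V \<and>
    (\<forall>u\<in>insert v V. infnorm u \<le> 1) \<and> 1 \<le> k \<and>
    (stop \<longrightarrow> insert v V \<subseteq> C \<and> (\<forall>u\<in>nonzero_vertices C - insert v V. searched I u) \<and>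
      (\<forall>j. 1 \<le> j \<and> j < k \<longrightarrow> search_dir dbar v j \<in> I))"
| "alg2_inv (Returned I C) \<longleftrightarrow> approximants I C \<and> (\<forall>u\<in>nonzero_vertices C. searched I u)"

lemma D2_solution_halfspace:
  assumes "D2_solution A m B A0 xbar d U w"
  shows "K \<subseteq> halfspace_le (w /\<^sub>R norm w) 0"
  using D2_feasible_inner_K[of d U w] assms
  by (auto simp: D2_solution_def halfspace_le_def intro!: mult_nonneg_nonpos)

lemma approximants_init:
  assumes "D2_solution A m B A0 xbar (- dbar) U w"
  shows "approximants (convex_cone hull {dbar}) (halfspace_le (w /\<^sub>R norm w) 0)"
  unfolding approximants_def
proof (intro conjI)
  show "convex_cone hull {dbar} \<subseteq> K"
    using dbar interior_subset by (intro hull_minimal convex_cone_K) auto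
qed (use D2_solution_halfspace[OF assms] in \<open>auto simp: polyhedral_cone_halfspace_le intro: hull_inc\<close>)

lemma approximants_cut:
  assumes "approximants I C" "D2_solution A m B A0 xbar d U w"
  shows "approximants I (C \<inter> halfspace_le (w /\<^sub>R norm w) 0)"
  using assms D2_solution_halfspace[OF assms(2)]
  by (auto simp: approximants_def intro: polyhedral_cone_Int polyhedral_cone_halfspace_le)

lemma approximants_extend:
  assumes "approximants I C" "d \<in> K"
  shows "approximants (convex_cone hull (I \<union> {d})) C"
proof -
  obtain F where F: "finite F" "I = convex_cone hull F"
    using assms(1) by (auto simp: approximants_def)
  have "convex_cone hull (I \<union> {d}) = convex_cone hull (F \<union> {d})"
    unfolding F(2) by (rule hull_Un_left[symmetric])
  moreover have "convex_cone hull (I \<union> {d}) \<subseteq> K"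
    using assms by (intro hull_minimal convex_cone_K) (auto simp: approximants_def)
  moreover have "dbar \<in> convex_cone hull (I \<union> {d})"
    using assms(1) by (auto simp: approximants_def intro: hull_inc)
  ultimately show ?thesis
    using assms(1) F(1) unfolding approximants_def by (metis finite.emptyI finite.insertI finite_UnI)
qed

lemma searched_mono: "searched I v \<Longrightarrow> I \<subseteq> J \<Longrightarrow> searched J v"
  by (auto simp: searched_def)

text \<open>The inner cone only grows, so searched vertices stay searched. A cut clears the flag,
  which makes the claims about the vertices of the outer cone vacuous.\<close>

lemma alg2_inv_step:
  assumes "step c c'" "alg2_inv c"
  shows "alg2_inv c'"
  using assms
proof (induction rule: alg2_step.induct)
  case (init U w)
  then show ?case by (simp add: approximants_init)
next
  case (begin_pass I C)
  then show ?case
    using finite_nonzero_vertices[of C] nonzero_verticesD[of _ C]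
    by (auto simp: approximants_def polyhedral_cone_def)
next
  case (dirs_done k v I C stop V)
  then show ?case by (auto simp: searched_def)
next
  case (dir_known k v I C stop V)
  then show ?case by (auto simp: less_Suc_eq)
next
  case (dir_unbounded k v I C stop V)
  let ?d = "search_dir dbar v k" and ?J = "convex_cone hull (I \<union> {search_dir dbar v k})"
  have "approximants ?J C"
    using dir_unbounded by (intro approximants_extend P2_unbounded_imp_K) auto
  moreover have J: "I \<subseteq> ?J" "?d \<in> ?J" using hull_subset[of "I \<union> {?d}" convex_cone] by auto
  ultimately show ?case
    using dir_unbounded.prems searched_mono[OF _ J(1)] by (auto simp: less_Suc_eq)
next
  case (dir_cut k v I U w C stop V)
  then show ?case by (auto intro: approximants_cut)
qed auto

lemma alg2_inv_reachable: "step\<^sup>*\<^sup>* Start c \<Longrightarrow> alg2_inv c"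
  by (induction rule: rtranclp_induct) (auto intro: alg2_inv_step)

lemma returned_approximations:
  assumes "alg2_inv (Returned I C)"
  shows "inner_approx \<epsilon> K I \<and> outer_approx \<epsilon> K C"
proof (rule cone_approximations)
  show "polyhedral_cone I"
    using assms by (auto simp: approximants_def polyhedral_cone_def polyhedron_convex_cone_hull
        convex_cone_convex_cone_hull)
  show "\<exists>p\<in>I. norm (v - p) \<le> \<epsilon>" if "v \<in> nonzero_vertices C" for v
    using assms that eps by (intro search_dir_approx) (auto simp: approximants_def searched_def)
qed (use assms eps in \<open>auto simp: approximants_def\<close>)

section \<open>Uniform depth of the cuts and termination\<close>

definition deep_cuts :: "real \<Rightarrow> bool" where
  "deep_cuts \<eta> \<longleftrightarrow> (\<forall>v k U w. infnorm v \<le> 1 \<longrightarrow> 1 \<le> k \<longrightarrow> k \<le> num_dirs \<epsilon> dbar v \<longrightarrow>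
    D2_solution A m B A0 xbar (search_dir dbar v k) U w \<longrightarrow> \<eta> \<le> (w /\<^sub>R norm w) \<bullet> v)"

text \<open>The ball of radius \<open>r\<close> around \<open>dbar\<close> inside \<open>K\<close> forces every normal vector \<open>w\<close> of a valid cut
  to satisfy \<open>w \<bullet> dbar \<le> - r * norm w\<close>.  As the search direction is a convex combination of \<open>v\<close> and
  \<open>dbar\<close> whose \<open>dbar\<close>-weight is bounded below, the cut passes \<open>v\<close> at a uniformly positive depth.\<close>

lemma ex_deep_cuts: "\<exists>\<eta>>0. deep_cuts \<eta>"
proof -
  obtain r where r: "0 < r" "cball dbar r \<subseteq> K"
    using dbar by (auto simp: mem_interior_cball)
  \<comment> \<open>\<open>R\<close> bounds the distance from \<open>dbar\<close> to points of the
    cube. So \<open>N\<close> bounds every \<open>num_dirs\<close>, and the weight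
    \<open>1 / 2 ^ k\<close> of \<open>dbar\<close> is at least \<open>1 / 2 ^ N\<close>.\<close>
  define R where "R = sqrt (DIM(real^'n)) + 1"
  define N where "N = nat \<lceil>log 2 (R / \<epsilon>)\<rceil>"
  have N: "num_dirs \<epsilon> dbar v \<le> N" if v: "infnorm v \<le> 1" for v :: "real^'n"
  proof (cases "v = dbar")
    case False
    have "norm v \<le> sqrt (DIM(real^'n)) * 1"
      by (rule order_trans[OF norm_le_infnorm mult_left_mono[OF v]]) simp
    then have "norm (v - dbar) \<le> R"
      using norm_triangle_ineq4[of v dbar] norm_dbar by (simp add: R_def)
    then have "log 2 (norm (v - dbar) / \<epsilon>) \<le> log 2 (R / \<epsilon>)"
      using False eps by (intro log_mono divide_right_mono) auto
    then show ?thesis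
      using False unfolding num_dirs_def N_def by (simp only: if_False nat_mono ceiling_mono)
  qed (simp add: num_dirs_def)
  show ?thesis
    unfolding deep_cuts_def
  proof (intro exI[of _ "r / 2 ^ N"] conjI allI impI)
    show "0 < r / 2 ^ N" using r by simp
    fix v :: "real^'n" and k U w
    assume v: "infnorm v \<le> 1" and k: "k \<le> num_dirs \<epsilon> dbar v" "1 \<le> k"
      and sol: "D2_solution A m B A0 xbar (search_dir dbar v k) U w"
    define a :: real where "a = 1 / 2 ^ k"
    have f: "D2_feasible A m B (search_dir dbar v k) U w" using sol by (simp add: D2_solution_def)
    then have d: "search_dir dbar v k \<bullet> w = 1" by (simp add: D2_feasible_def)
    then have "w \<noteq> 0" by auto
    then have nw: "0 < norm w" by simp
    have a: "0 < a" "a \<le> 1" "r / 2 ^ N \<le> a * r"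
      using k N[OF v] r by (auto simp: a_def field_simps)
    \<comment> \<open>The point of the ball around \<open>dbar\<close> that lies farthest in
      direction \<open>w\<close>.\<close>
    have "dbar + (r / norm w) *\<^sub>R w \<in> K"
      using r nw by (intro subsetD[OF r(2)]) (simp add: dist_norm)
    from D2_feasible_inner_K[OF f this] have "w \<bullet> dbar + (r / norm w) * (w \<bullet> w) \<le> 0"
      by (simp add: inner_add_right)
    then have wd: "w \<bullet> dbar \<le> - (r * norm w)"
      using nw by (simp add: dot_square_norm power2_eq_square)
    have "(1 - a) * (w \<bullet> v) + a * (w \<bullet> dbar) = 1"
      using d unfolding inner_commute[of _ w]
      by (simp add: search_dir_def a_def inner_add_right diff_divide_distrib)
    moreover have "a * (w \<bullet> dbar) \<le> a * - (r * norm w)" by (rule mult_left_mono[OF wd]) (use a in simp)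
    ultimately have *: "a * r * norm w \<le> (1 - a) * (w \<bullet> v)" by simp
    have pos: "0 < a * r * norm w" using a r nw by simp
    \<comment> \<open>Positivity is needed before the factor \<open>1 - a\<close> can be replaced by
      1.\<close>
    then have "0 < w \<bullet> v" using * a(2)
      by (metis diff_ge_0_iff_ge linorder_not_le mult_nonneg_nonpos order_less_le_trans)
    then have "(1 - a) * (w \<bullet> v) \<le> 1 * (w \<bullet> v)" using a by (intro mult_right_mono) auto
    with * have "a * r \<le> (w \<bullet> v) / norm w" using nw by (simp add: field_simps)
    with a(3) show "r / 2 ^ N \<le> (w /\<^sub>R norm w) \<bullet> v"
      by (simp add: divide_inverse mult.commute)
  qed
qed

text \<open>Termination: the part of the unit cube in the outer cone loses packing number with the first
  cut of a pass; between two such cuts the stage of the pass, the number of pending vertices and the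
  number of pending directions decrease lexicographically.\<close>

definition outer_packing :: "real \<Rightarrow> (real^'n) set \<Rightarrow> nat" where
  "outer_packing \<eta> C = packing_number \<eta> (C \<inter> {x. infnorm x \<le> 1})"

fun packing_rank :: "real \<Rightarrow> (real^'n) alg2_config \<Rightarrow> nat" where
  "packing_rank \<eta> Start = Suc (Suc (outer_packing \<eta> UNIV))"
| "packing_rank \<eta> (Pass I C) = Suc (outer_packing \<eta> C)"
| "packing_rank \<eta> (Vertices I C stop V) = Suc (outer_packing \<eta> C)"
| "packing_rank \<eta> (Dirs I C stop V v k) = Suc (outer_packing \<eta> C)"
| "packing_rank \<eta> (Returned I C) = 0"

text \<open>With an unchanged packing number, a pass that has cut (2) leads to a new
  \<open>Pass\<close> (1) and then to a pass without cuts (0). Only a first cut goes back up to 2,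
  and it lowers the packing number.\<close>

fun stage_rank :: "(real^'n) alg2_config \<Rightarrow> nat" where
  "stage_rank (Vertices I C stop V) = (if stop then 0 else 2)"
| "stage_rank (Dirs I C stop V v k) = (if stop then 0 else 2)"
| "stage_rank _ = 1"

fun vertices_rank :: "(real^'n) alg2_config \<Rightarrow> nat" where
  "vertices_rank (Vertices I C stop V) = card V"
| "vertices_rank (Dirs I C stop V v k) = card V"
| "vertices_rank _ = 0"

text \<open>The outer \<open>Suc\<close> keeps the rank positive when all directions are exhausted,
  so leaving the inner loop still decreases it.\<close>

fun dirs_rank :: "(real^'n) alg2_config \<Rightarrow> nat" where
  "dirs_rank (Dirs I C stop V v k) = Suc (Suc (num_dirs \<epsilon> dbar v) - k)"
| "dirs_rank _ = 0"

definition alg2_order :: "real \<Rightarrow> ((real^'n) alg2_config \<times> (real^'n) alg2_config) set" where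
  "alg2_order \<eta> = measures [packing_rank \<eta>, stage_rank, vertices_rank, dirs_rank]"

lemma outer_packing_mono: "0 < \<eta> \<Longrightarrow> C' \<subseteq> C \<Longrightarrow> outer_packing \<eta> C' \<le> outer_packing \<eta> C"
  unfolding outer_packing_def
  by (rule packing_number_mono[OF compact_infnorm_ball[of 1]]) auto

text \<open>Pairing with the normalised \<open>w\<close> is 1-Lipschitz; it is at least
  \<open>\<eta>\<close> at \<open>v\<close> and at most 0 on what remains, so \<open>v\<close> is at
  distance at least \<open>\<eta>\<close> from the remainder.\<close>

lemma outer_packing_cut_less:
  assumes "0 < \<eta>" "v \<in> C" "infnorm v \<le> 1" "\<eta> \<le> (w /\<^sub>R norm w) \<bullet> v"
  shows "outer_packing \<eta> (C \<inter> halfspace_le (w /\<^sub>R norm w) 0) < outer_packing \<eta> C"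
  unfolding outer_packing_def
proof (rule packing_number_less[OF compact_infnorm_ball[of 1]])
  fix x assume "x \<in> C \<inter> halfspace_le (w /\<^sub>R norm w) 0 \<inter> {x. infnorm x \<le> 1}"
  then have "(w /\<^sub>R norm w) \<bullet> x \<le> 0" by (simp add: halfspace_le_def)
  then have "\<eta> \<le> (w /\<^sub>R norm w) \<bullet> (v - x)" using assms(4) by (simp only: inner_diff_right)
  also have "\<dots> \<le> norm (w /\<^sub>R norm w) * norm (v - x)" by (rule norm_cauchy_schwarz)
  also have "\<dots> \<le> 1 * norm (v - x)" by (intro mult_right_mono) (cases "w = 0", auto)
  finally show "\<eta> \<le> dist v x" by (simp add: dist_norm)
qed (use assms in auto)

lemma step_decreases:
  assumes \<eta>: "0 < \<eta>" "deep_cuts \<eta>"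
    and "step c c'" "alg2_inv c"
  shows "(c', c) \<in> alg2_order \<eta>"
  using assms(3,4) unfolding alg2_order_def
proof (induction rule: alg2_step.induct)
  case (init U w)
  have "outer_packing \<eta> (halfspace_le (w /\<^sub>R norm w) 0) \<le> outer_packing \<eta> UNIV"
    by (rule outer_packing_mono[OF \<eta>(1)]) simp
  then show ?case by simp
next
  case (next_vertex v V I C stop)
  then have "0 < card V" by (auto simp: card_gt_0_iff)
  then show ?case using next_vertex by simp
next
  case (dir_cut k v I U w C stop V)
  let ?C = "C \<inter> halfspace_le (w /\<^sub>R norm w) 0"
  show ?case
  proof (cases stop)
    case True
    then have "outer_packing \<eta> ?C < outer_packing \<eta> C"
      using dir_cut \<eta> by (intro outer_packing_cut_less) (auto simp: deep_cuts_def)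
    then show ?thesis by simp
  next
    \<comment> \<open>After an earlier cut \<open>v\<close> may already lie outside
      \<open>C\<close>, so the packing number need not drop; leaving the inner loop then lowers
      \<open>dirs_rank\<close>.\<close>
    case False
    have "outer_packing \<eta> ?C \<le> outer_packing \<eta> C"
      by (rule outer_packing_mono[OF \<eta>(1)]) simp
    then show ?thesis using False by auto
  qed
qed auto

lemma no_infinite_run: "\<nexists>run. run 0 = Start \<and> (\<forall>i. step (run i) (run (Suc i)))"
proof
  assume "\<exists>run. run 0 = Start \<and> (\<forall>i. step (run i) (run (Suc i)))"
  then obtain run where run: "run 0 = Start" "\<And>i. step (run i) (run (Suc i))" by blast
  obtain \<eta> where \<eta>: "0 < \<eta>" "deep_cuts \<eta>"
    using ex_deep_cuts by blast
  have "alg2_inv (run i)" for i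
    by (induction i) (auto simp: run(1) intro: alg2_inv_step[OF run(2)])
  then have "(run (Suc i), run i) \<in> alg2_order \<eta>" for i
    using step_decreases[OF \<eta> run(2)] by blast
  moreover have "wf (alg2_order \<eta>)" by (simp add: alg2_order_def)
  ultimately show False by (metis wf_no_infinite_down_chainE)
qed

end

theorem theorem4p4:
  fixes A :: "'n::finite \<Rightarrow> real^'l^'l" and m :: nat and B :: "nat \<Rightarrow> real^'l^'l"
    and A0 :: "real^'l^'l" and S :: "(real^'n) set"
    and xbar dbar :: "real^'n" and \<epsilon> :: real
  assumes "sym_mat A0" and "\<And>i. sym_mat (A i)" and "\<And>j. j \<in> {1..m} \<Longrightarrow> sym_mat (B j)"
    and "S = shadow A m B A0"
    and "closed S" and "S \<noteq> UNIV"
    and "\<exists>ybar. pos_def (lin_x A xbar + lin_y m B ybar + A0)"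
    and "dbar \<in> interior (recession_cone S)" and "norm dbar \<le> 1"
    and "\<epsilon> > 0"
  shows
    "(\<nexists>run. run 0 = Start \<and>
        (\<forall>i::nat. alg2_step A m B A0 xbar dbar \<epsilon> (run i) (run (Suc i)))) \<and>
     (\<forall>c. (alg2_step A m B A0 xbar dbar \<epsilon>)\<^sup>*\<^sup>* Start c \<longrightarrow>
        (\<exists>c'. alg2_step A m B A0 xbar dbar \<epsilon> c c') \<or> (\<exists>Inn Out. c = Returned Inn Out)) \<and>
     (\<forall>Inn Out. (alg2_step A m B A0 xbar dbar \<epsilon>)\<^sup>*\<^sup>* Start (Returned Inn Out) \<longrightarrow>
        inner_approx \<epsilon> (recession_cone S) Inn \<and> outer_approx \<epsilon> (recession_cone S) Out)"
proof -
  interpret alg2_input A m B A0 xbar dbar \<epsilon>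
    using assms by unfold_locales auto
  show ?thesis
    using no_infinite_run step_progress returned_approximations alg2_inv_reachable
    unfolding \<open>S = shadow A m B A0\<close> by blast
qed

end
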